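(* Let $X$ be a real Hilbert space, let $f,g\colon X\to\,]-\infty,+\infty]$ be proper lower semicontinuous convex functions, and set $\widetilde{T}=R_gR_f$. Let $\mathsf v=P_{\overline{\operatorname{ran}}(\mathrm{Id}-T)}(0)$, where $T=\tfrac12(\mathrm{Id}+R_gR_f)$, and let $Z=\{x\in X: 0\in-\mathsf v+\partial f(x)+\partial g(x-\mathsf v)\}$. Suppose that $Z\neq\varnothing$ and that $f$ is uniformly convex on $X$. Then there exists $\overline{x}\in X$ such that $Z=\operatorname{argmin}\big(-\langle\cdot,\mathsf v\rangle+f+g(\cdot-\mathsf v)\big)=\{\overline{x}\}$. Moreover, for every $x\in X$, $\operatorname{Prox}_f\widetilde{T}^nx\to\overline{x}$ in norm as $n\to\infty$.
   Context: $\operatorname{Prox}_f=(\mathrm{Id}+\partial f)^{-1}$ is the proximal mapping of $f$, $R_f=2\operatorname{Prox}_f-\mathrm{Id}$, and similarly for $g$; $\partial f$ is the convex subdifferential. The set $\overline{\operatorname{ran}}(\mathrm{Id}-T)$ is the closure of the range of $\mathrm{Id}-T$; it is nonempty, closed and convex, and $P_D$ denotes the metric projection onto a nonempty closed convex set $D$. $\operatorname{argmin}$ denotes the set of minimizers over $X$. A proper function $h$ is uniformly convex with modulus $\phi\colon\mathbb{R}_+\to[0,+\infty]$ if $\phi$ is increasing, vanishes only at $0$, and $h(\alpha x+(1-\alpha)y)+\alpha(1-\alpha)\phi(\|x-y\|)\le\alpha h(x)+(1-\alpha)h(y)$ for all $x,y\in\operatorname{dom}h$ and $\alpha\in\,]0,1[$;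 it is uniformly convex if this holds for some such $\phi$. *)

theory Defs
  imports "HOL-Analysis.Analysis"
begin

definition eff_domain :: "('a \<Rightarrow> ereal) \<Rightarrow> 'a set" where
  "eff_domain f = {x. f x < \<infinity>}"

definition proper_fun :: "('a \<Rightarrow> ereal) \<Rightarrow> bool" where
  "proper_fun f \<longleftrightarrow> (\<forall>x. f x \<noteq> -\<infinity>) \<and> eff_domain f \<noteq> {}"

definition lsc_fun :: "('a::topological_space \<Rightarrow> ereal) \<Rightarrow> bool" where
  "lsc_fun f \<longleftrightarrow> (\<forall>x. f x \<le> Liminf (at x) f)"

definition epigraph :: "('a \<Rightarrow> ereal) \<Rightarrow> ('a \<times> real) set" where
  "epigraph f = {(x, r). f x \<le> ereal r}"

definition convex_fun :: "('a::real_vector \<Rightarrow> ereal) \<Rightarrow> bool" where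
  "convex_fun f \<longleftrightarrow> convex (epigraph f)"

text \<open>``Increasing'' is read in the non-strict sense, the weaker hypothesis.\<close>

definition uniformly_convex_with ::
  "(real \<Rightarrow> ereal) \<Rightarrow> ('a::real_normed_vector \<Rightarrow> ereal) \<Rightarrow> bool" where
  "uniformly_convex_with \<phi> h \<longleftrightarrow>
     mono_on {0..} \<phi> \<and>
     (\<forall>t\<ge>0. 0 \<le> \<phi> t) \<and>
     (\<forall>t\<ge>0. \<phi> t = 0 \<longleftrightarrow> t = 0) \<and>
     (\<forall>x\<in>eff_domain h. \<forall>y\<in>eff_domain h. \<forall>\<alpha>\<in>{0<..<1}.
        h (\<alpha> *\<^sub>R x + (1 - \<alpha>) *\<^sub>R y) + ereal (\<alpha> * (1 - \<alpha>)) * \<phi> (norm (x - y))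
          \<le> ereal \<alpha> * h x + ereal (1 - \<alpha>) * h y)"

definition uniformly_convex :: "('a::real_normed_vector \<Rightarrow> ereal) \<Rightarrow> bool" where
  "uniformly_convex h \<longleftrightarrow> (\<exists>\<phi>. uniformly_convex_with \<phi> h)"

text \<open>For proper \<open>f\<close> this set is empty outside the effective domain of \<open>f\<close>.\<close>

definition subdifferential :: "('a::real_inner \<Rightarrow> ereal) \<Rightarrow> 'a \<Rightarrow> 'a set" where
  "subdifferential f x = {u. \<forall>y. f x + ereal (u \<bullet> (y - x)) \<le> f y}"

text \<open>The set-valued inverse of \<open>Id + \<partial>f\<close> is single-valued with full domain when \<open>f\<close> is
  proper, lower semicontinuous and convex on a Hilbert space, so \<open>THE\<close> selects its unique value.\<close>

definition prox :: "('a::real_inner \<Rightarrow> ereal) \<Rightarrow> 'a \<Rightarrow> 'a" where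
  "prox f x = (THE p. x \<in> {p + u | u. u \<in> subdifferential f p})"

definition refl_prox :: "('a::real_inner \<Rightarrow> ereal) \<Rightarrow> 'a \<Rightarrow> 'a" where
  "refl_prox f x = 2 *\<^sub>R prox f x - x"

text \<open>The library's \<^const>\<open>closest_point\<close> is restricted to Heine-Borel spaces, which excludes
  infinite-dimensional Hilbert spaces.\<close>

definition metric_proj :: "'a::metric_space set \<Rightarrow> 'a \<Rightarrow> 'a" where
  "metric_proj D x = (THE p. p \<in> D \<and> (\<forall>y\<in>D. dist x p \<le> dist x y))"

definition argmin_set :: "('a \<Rightarrow> ereal) \<Rightarrow> 'a set" where
  "argmin_set F = {x. is_arg_min F (\<lambda>_. True) x}"

end

theory Submission
  imports Defs
begin

text \<open>
  Put \<open>A = Id - T\<close>. Its range has a convex closure, so \<open>v\<close> is the unique element of minimal norm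
  there, and \<open>Z \<noteq> {}\<close> means that \<open>v = z - T z\<close> for some \<open>z\<close>. As \<open>Ttilde\<close> is nonexpansive,
  \<open>Ttilde z - Ttilde (Ttilde z)\<close> has norm at most \<open>norm (2 v)\<close>, hence equals \<open>2 v\<close>; inductively every
  iterate of \<open>z\<close> is again a solution of \<open>z - T z = v\<close>, so its proximal point lies in \<open>Z\<close>, which is a
  singleton by uniform convexity. For an arbitrary \<open>x\<close> the distance between the orbits of \<open>x\<close> and \<open>z\<close>
  decreases, and its decrease dominates the monotonicity gap of the subdifferential of \<open>f\<close> along the
  two shadow sequences. The gap therefore tends to zero, and uniform monotonicity makes the shadows
  merge.
\<close>

section \<open>Minimizers of midpoint-strongly convex functions\<close>

lemma lsc_fun_eventually_nhds:
  assumes "lsc_fun f" "c < f x"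
  shows "\<forall>\<^sub>F y in nhds x. c < f y"
proof -
  have "c < Liminf (at x) f"
    using assms unfolding lsc_fun_def by (meson less_le_trans)
  then have "\<forall>\<^sub>F y in at x. c < f y"
    by (rule less_LiminfD)
  then show ?thesis
    using assms(2) by (simp add: eventually_nhds_conv_at)
qed

text \<open>The midpoint of two near-minimizers cannot fall below the infimum, so \<open>mid\<close>
  forces them close together. Minimizing sequences are therefore Cauchy, and lower semicontinuity
  passes the infimum to the limit. Real upper bounds \<open>r\<close>, \<open>s\<close> in
  \<open>mid\<close> avoid arithmetic with infinite values.\<close>

lemma midpoint_strongly_convex_attains_min:
  fixes F :: "'a::{real_normed_vector, complete_space} \<Rightarrow> ereal"
  assumes lsc: "\<And>x c. ereal c < F x \<Longrightarrow> \<forall>\<^sub>F y in nhds x. ereal c < F y"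
    and bdd: "\<And>x. ereal m \<le> F x"
    and proper: "F w < \<infinity>"
    and "c > 0"
    and mid: "\<And>x y r s. F x \<le> ereal r \<Longrightarrow> F y \<le> ereal s \<Longrightarrow>
      F (midpoint x y) \<le> ereal ((r + s) / 2 - c * (dist x y)\<^sup>2)"
  shows "\<exists>p. \<forall>y. F p \<le> F y"
proof -
  have "ereal m \<le> (INF x. F x)"
    using bdd by (simp add: INF_greatest)
  moreover have "(INF x. F x) < \<infinity>"
    using proper by (meson INF_lower UNIV_I le_less_trans)
  ultimately obtain \<mu> where \<mu>: "(INF x. F x) = ereal \<mu>"
    by (cases "INF x. F x") auto
  have \<mu>_le: "ereal \<mu> \<le> F x" for x
    using \<mu> by (metis INF_lower UNIV_I)
  have "\<exists>x. F x \<le> ereal (\<mu> + 1 / Suc n)" for n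
  proof -
    have "(INF x. F x) < ereal (\<mu> + 1 / Suc n)"
      unfolding \<mu> by simp
    then show ?thesis
      by (auto simp: INF_less_iff intro: less_imp_le)
  qed
  then obtain X where X: "\<And>n. F (X n) \<le> ereal (\<mu> + 1 / Suc n)"
    by metis
  have dist_X: "c * (dist (X i) (X j))\<^sup>2 \<le> 1 / Suc N" if "N \<le> i" "N \<le> j" for i j N
  proof -
    have "F (X k) \<le> ereal (\<mu> + 1 / Suc N)" if "N \<le> k" for k
    proof -
      have "1 / real (Suc k) \<le> 1 / real (Suc N)"
        using that by (intro divide_left_mono) auto
      then show ?thesis
        using X[of k] by (meson add_left_mono ereal_less_eq(3) order_trans)
    qed
    moreover have "(r + r) / 2 = r" for r :: real by simp
    ultimately have "F (midpoint (X i) (X j)) \<le> ereal (\<mu> + 1 / Suc N - c * (dist (X i) (X j))\<^sup>2)"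
      using mid[of "X i" "\<mu> + 1 / Suc N" "X j" "\<mu> + 1 / Suc N"] that by (simp only:)
    from order_trans[OF \<mu>_le this] show ?thesis by simp
  qed
  have "Cauchy X"
  proof (rule metric_CauchyI)
    fix e :: real assume "e > 0"
    then have "c * e\<^sup>2 > 0" using \<open>c > 0\<close> by simp
    then obtain N where N: "1 / real (Suc N) < c * e\<^sup>2"
      using nat_approx_posE by blast
    have "dist (X i) (X j) < e" if "N \<le> i" "N \<le> j" for i j
    proof -
      have "c * (dist (X i) (X j))\<^sup>2 < c * e\<^sup>2"
        using dist_X[OF that] N by linarith
      then show ?thesis
        using \<open>c > 0\<close> \<open>e > 0\<close> by (simp add: power_less_imp_less_base)
    qed
    then show "\<exists>M. \<forall>i\<ge>M. \<forall>j\<ge>M. dist (X i) (X j) < e" by blast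
  qed
  then obtain p where p: "X \<longlonglongrightarrow> p"
    using Cauchy_convergent_iff convergent_def by blast
  have "F p \<le> ereal \<mu>"
  proof (rule ccontr)
    assume "\<not> F p \<le> ereal \<mu>"
    then obtain e where e: "ereal \<mu> < ereal e" "ereal e < F p"
      by (meson ereal_dense2 not_le)
    have "\<forall>\<^sub>F n in sequentially. ereal e < F (X n)"
      using lsc[OF e(2)] p by (rule eventually_compose_filterlim)
    moreover have "\<forall>\<^sub>F n in sequentially. 1 / real (Suc n) < e - \<mu>"
      using e(1) by (intro order_tendstoD(2)[OF LIMSEQ_Suc[OF lim_1_over_n]]) simp
    ultimately have "\<forall>\<^sub>F n in sequentially. False"
    proof eventually_elim
      case (elim n)
      then have "ereal (\<mu> + 1 / Suc n) < ereal e" by simp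
      with X[of n] elim show False by (metis leD less_trans order.strict_trans1)
    qed
    then show False by simp
  qed
  then show ?thesis
    using \<mu>_le order_trans by blast
qed

section \<open>Nearest points in closed convex sets\<close>

text \<open>The parallelogram law; it supplies the constant 1/4 for squared distances and 1/8 for
  half of them.\<close>

lemma dist_midpoint_sq:
  fixes x y z :: "'a::real_inner"
  shows "(dist z (midpoint x y))\<^sup>2 = ((dist z x)\<^sup>2 + (dist z y)\<^sup>2) / 2 - (1/4) * (dist x y)\<^sup>2"
  unfolding dist_norm midpoint_def power2_norm_eq_inner
  by (simp add: inner_simps inner_commute field_simps)

text \<open>Existence and uniqueness of the nearest point give the \<open>THE\<close> in
  \<open>metric_proj\<close> its meaning; being no farther away then identifies a point with the
  projection.\<close>

lemma metric_proj_unique: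
  fixes D :: "'a::{real_inner, complete_space} set"
  assumes "closed D" "convex D" "y \<in> D" "dist x y \<le> dist x (metric_proj D x)"
  shows "y = metric_proj D x"
proof -
  have mid: "midpoint y z \<in> D" if "y \<in> D" "z \<in> D" for y z
    using that assms(2) by (meson closed_segment_subset midpoint_in_closed_segment subsetD)
  \<comment> \<open>The value infinity encodes the constraint: closedness of \<open>D\<close> yields
    lower semicontinuity, convexity yields the midpoint inequality.\<close>
  define F where "F = (\<lambda>y. if y \<in> D then ereal ((dist x y)\<^sup>2) else \<infinity>)"
  have F_leD: "y \<in> D \<and> (dist x y)\<^sup>2 \<le> r" if "F y \<le> ereal r" for y r
    using that by (auto simp: F_def split: if_splits)
  have "\<exists>p. \<forall>y. F p \<le> F y"
  proof (rule midpoint_strongly_convex_attains_min[where m = 0 and c = "1/4" and w = y])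
    fix y c assume c: "ereal c < F y"
    show "\<forall>\<^sub>F z in nhds y. ereal c < F z"
    proof (cases "y \<in> D")
      case True
      have "((\<lambda>z. (dist x z)\<^sup>2) \<longlongrightarrow> (dist x y)\<^sup>2) (nhds y)"
        by (intro tendsto_intros filterlim_ident)
      then have "\<forall>\<^sub>F z in nhds y. c < (dist x z)\<^sup>2"
        using c True by (intro order_tendstoD) (auto simp: F_def)
      then show ?thesis by eventually_elim (auto simp: F_def)
    next
      case False
      then have "\<forall>\<^sub>F z in nhds y. z \<in> - D"
        using assms(1) by (intro eventually_nhds_in_open) auto
      then show ?thesis by eventually_elim (auto simp: F_def)
    qed
  next
    fix y z r s assume "F y \<le> ereal r" "F z \<le> ereal s"
    then have yz: "y \<in> D" "z \<in> D" "(dist x y)\<^sup>2 \<le> r" "(dist x z)\<^sup>2 \<le> s"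
      using F_leD by blast+
    then have "F (midpoint y z) = ereal ((dist x (midpoint y z))\<^sup>2)"
      using mid by (simp add: F_def)
    moreover have "(dist x (midpoint y z))\<^sup>2 \<le> (r + s) / 2 - (1/4) * (dist y z)\<^sup>2"
      unfolding dist_midpoint_sq using yz(3,4) by (intro diff_mono divide_right_mono add_mono) auto
    ultimately show "F (midpoint y z) \<le> ereal ((r + s) / 2 - (1/4) * (dist y z)\<^sup>2)"
      by (simp only: ereal_less_eq)
  qed (use \<open>y \<in> D\<close> in \<open>auto simp: F_def\<close>)
  then obtain p where p: "\<And>y. F p \<le> F y" by blast
  have "p \<in> D"
    using p[of y] \<open>y \<in> D\<close> by (auto simp: F_def split: if_splits)
  have p_le: "dist x p \<le> dist x y" if "y \<in> D" for y
    using p[of y] \<open>p \<in> D\<close> that by (simp add: F_def abs_le_square_iff[symmetric])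
  \<comment> \<open>The midpoint of two distinct nearest points would be strictly nearer.\<close>
  have p_unique: "y = p" if "y \<in> D" "dist x y \<le> dist x p" for y
  proof -
    have "(dist x y)\<^sup>2 \<le> (dist x p)\<^sup>2" using that(2) by (simp add: power_mono)
    moreover have "(dist x p)\<^sup>2 \<le> (dist x (midpoint p y))\<^sup>2"
      using p_le[OF mid[OF \<open>p \<in> D\<close> that(1)]] by (simp add: power_mono)
    moreover have "c \<le> 0" if "a \<le> b" "b \<le> (b + a) / 2 - (1/4) * c" for a b c :: real
      using that by (simp add: field_simps)
    ultimately have "(dist p y)\<^sup>2 \<le> 0"
      unfolding dist_midpoint_sq by blast
    then show ?thesis by simp
  qed
  have proj: "metric_proj D x = p"
    unfolding metric_proj_def
    using \<open>p \<in> D\<close> p_le p_unique by (intro the_equality) auto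
  show ?thesis
    using p_unique assms(3,4) unfolding proj by blast
qed

section \<open>Displacements of nonexpansive maps\<close>

text \<open>The equation is the fixed point equation of \<open>G\<close>, a contraction with factor
  \<open>1 / (1 + e)\<close>.\<close>

lemma nonexpansive_resolvent:
  fixes T :: "'a::{real_normed_vector, complete_space} \<Rightarrow> 'a"
  assumes nonexp: "\<And>x y. norm (T x - T y) \<le> norm (x - y)" and "e > 0"
  shows "\<exists>y. y - T y + e *\<^sub>R y = w"
proof -
  define G where "G = (\<lambda>y. (1 / (1 + e)) *\<^sub>R (w + T y))"
  have "dist (G x) (G y) \<le> (1 / (1 + e)) * dist x y" for x y
    using nonexp[of x y] \<open>e > 0\<close>
    by (simp add: G_def dist_norm scaleR_diff_right[symmetric] divide_right_mono)
  then have "\<exists>!y. G y = y"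
    using \<open>e > 0\<close> by (intro banach_fix_type[where c = "1 / (1 + e)"]) auto
  then obtain y where "G y = y" by blast
  moreover have "(1 + e) *\<^sub>R G y = w + T y"
    using \<open>e > 0\<close> by (simp add: G_def)
  ultimately have "(1 + e) *\<^sub>R y = w + T y" by simp
  then show ?thesis
    by (intro exI[of _ y]) (simp add: algebra_simps)
qed

lemma nonexpansive_displacement_monotone:
  fixes T :: "'a::real_inner \<Rightarrow> 'a"
  assumes "\<And>x y. norm (T x - T y) \<le> norm (x - y)"
  shows "0 \<le> ((x - T x) - (y - T y)) \<bullet> (x - y)"
proof -
  have "(T x - T y) \<bullet> (x - y) \<le> norm (T x - T y) * norm (x - y)"
    by (rule norm_cauchy_schwarz)
  also have "\<dots> \<le> norm (x - y) * norm (x - y)"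
    using assms by (intro mult_right_mono) auto
  also have "\<dots> = (x - y) \<bullet> (x - y)"
    by (simp add: power2_norm_eq_inner[symmetric] power2_eq_square)
  finally show ?thesis by (simp add: inner_diff_left)
qed

text \<open>
  For \<open>w\<close> on the segment between two displacements, solve \<open>y - T y + e y = w\<close>. Averaging the two
  monotonicity inequalities at \<open>y\<close> bounds \<open>e * norm y ^ 2\<close> by \<open>K * e * norm y + C\<close>, so \<open>e y\<close> tends
  to \<open>0\<close> with \<open>e\<close>.
\<close>

lemma nonexpansive_segment_displacement:
  fixes T :: "'a::{real_inner, complete_space} \<Rightarrow> 'a"
  assumes nonexp: "\<And>x y. norm (T x - T y) \<le> norm (x - y)"
    and "0 \<le> s" "0 \<le> t" "s + t = 1"
  shows "s *\<^sub>R (a - T a) + t *\<^sub>R (b - T b) \<in> closure (range (\<lambda>x. x - T x))"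
    (is "?w \<in> _")
proof -
  define A where "A = (\<lambda>x. x - T x)"
  have w: "?w = s *\<^sub>R A a + t *\<^sub>R A b" by (simp add: A_def)
  define K where "K = norm (s *\<^sub>R a + t *\<^sub>R b)"
  define C where "C = \<bar>s * ((?w - A a) \<bullet> a) + t * ((?w - A b) \<bullet> b)\<bar>"
  have key: "e * (norm y)\<^sup>2 \<le> K * (e * norm y) + C" if y: "A y + e *\<^sub>R y = ?w" and "e > 0" for y e
  proof -
    have Ay: "A y = ?w - e *\<^sub>R y" using y by (simp add: algebra_simps)
    have mono: "0 \<le> (A y - A x) \<bullet> (y - x)" for x
      unfolding A_def by (rule nonexpansive_displacement_monotone[OF nonexp])
    have "0 \<le> s * ((A y - A a) \<bullet> (y - a)) + t * ((A y - A b) \<bullet> (y - b))"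
      using mono assms by simp
    also have "\<dots> = ((s + t) *\<^sub>R A y - ?w) \<bullet> y
        - s * ((A y - A a) \<bullet> a) - t * ((A y - A b) \<bullet> b)"
      unfolding w by (simp add: inner_simps algebra_simps)
    also have "\<dots> = - e * (y \<bullet> y) + e * (y \<bullet> (s *\<^sub>R a + t *\<^sub>R b))
        - (s * ((?w - A a) \<bullet> a) + t * ((?w - A b) \<bullet> b))"
      unfolding assms(4) Ay by (simp add: inner_simps algebra_simps)
    also have "\<dots> \<le> - e * (y \<bullet> y) + e * (norm y * K) + C"
    proof -
      have "e * (y \<bullet> (s *\<^sub>R a + t *\<^sub>R b)) \<le> e * (norm y * K)"
        unfolding K_def using \<open>e > 0\<close> by (intro mult_left_mono norm_cauchy_schwarz) auto
      then show ?thesis unfolding C_def by linarith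
    qed
    finally show ?thesis by (simp add: power2_norm_eq_inner algebra_simps)
  qed
  have "\<exists>y. norm (A y - ?w) < d" if "d > 0" for d
  proof -
    \<comment> \<open>With this \<open>e\<close>, the inequality
      \<open>u\<^sup>2 \<le> e * (K * u + C)\<close> derived below fails at \<open>u = d\<close>,
      and then for every larger \<open>u\<close>, since a square outgrows an affine function. The
      summand 1 makes the failure strict.\<close>
    define e where "e = d\<^sup>2 / (K * d + C + 1)"
    have KC: "0 \<le> K" "0 \<le> C" by (auto simp: K_def C_def)
    have den: "0 < K * d + C + 1" using KC that by (simp add: add_nonneg_pos)
    have "e > 0" unfolding e_def using den that by simp
    obtain y where y: "A y + e *\<^sub>R y = ?w"
      using nonexpansive_resolvent[OF nonexp \<open>e > 0\<close>, of ?w] by (auto simp: A_def)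
    define u where "u = e * norm y"
    have "u\<^sup>2 = e * (e * (norm y)\<^sup>2)" by (simp add: u_def power2_eq_square)
    also have "\<dots> \<le> e * (K * u + C)"
      using key[OF y \<open>e > 0\<close>] \<open>e > 0\<close> by (simp add: u_def)
    finally have u: "u\<^sup>2 \<le> e * (K * u + C)" .
    have "u < d"
    proof (rule ccontr)
      assume "\<not> u < d"
      then have "d \<le> u" by simp
      have "d * u \<le> u * u" using \<open>d \<le> u\<close> that by (intro mult_right_mono) auto
      have "d * (K * u + C) \<le> u * (K * d + C)"
        using mult_right_mono[OF \<open>d \<le> u\<close> KC(2)] by (simp add: algebra_simps)
      have "u\<^sup>2 * (K * d + C + 1) \<le> d\<^sup>2 * (K * u + C)"
        using u den by (simp add: e_def field_simps)
      moreover have "d\<^sup>2 * (K * u + C) \<le> u * d * (K * d + C)"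
        using mult_left_mono[OF \<open>d * (K * u + C) \<le> u * (K * d + C)\<close>, of d] that
        by (simp add: power2_eq_square algebra_simps)
      moreover have "u * d * (K * d + C) \<le> u\<^sup>2 * (K * d + C)"
        using \<open>d * u \<le> u * u\<close> KC that
        by (intro mult_right_mono) (auto simp: power2_eq_square mult.commute)
      moreover have "0 < u\<^sup>2" using \<open>d \<le> u\<close> that by simp
      ultimately show False by (simp add: algebra_simps)
    qed
    moreover have "norm (A y - ?w) = u"
      using y[symmetric] \<open>e > 0\<close> by (simp add: u_def)
    ultimately show ?thesis by metis
  qed
  then show ?thesis
    unfolding closure_approachable A_def[symmetric] dist_norm by auto
qed

text \<open>Segments between exact displacements are already covered; points of the closure are
  reached by sequences.\<close>

lemma convex_closure_nonexpansive_displacement: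
  fixes T :: "'a::{real_inner, complete_space} \<Rightarrow> 'a"
  assumes "\<And>x y. norm (T x - T y) \<le> norm (x - y)"
  shows "convex (closure (range (\<lambda>x. x - T x)))"
proof (rule convexI)
  fix x y :: 'a and s t :: real
  let ?R = "range (\<lambda>x. x - T x)"
  assume xy: "x \<in> closure ?R" "y \<in> closure ?R" and st: "0 \<le> s" "0 \<le> t" "s + t = 1"
  obtain X where X: "\<And>n. X n \<in> ?R" "X \<longlonglongrightarrow> x" using xy(1) closure_sequential by blast
  obtain Y where Y: "\<And>n. Y n \<in> ?R" "Y \<longlonglongrightarrow> y" using xy(2) closure_sequential by blast
  have "s *\<^sub>R X n + t *\<^sub>R Y n \<in> closure ?R" for n
    using X(1)[of n] Y(1)[of n] nonexpansive_segment_displacement[OF assms st] by auto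
  moreover have "(\<lambda>n. s *\<^sub>R X n + t *\<^sub>R Y n) \<longlonglongrightarrow> s *\<^sub>R x + t *\<^sub>R y"
    using X(2) Y(2) by (intro tendsto_intros)
  ultimately show "s *\<^sub>R x + t *\<^sub>R y \<in> closure ?R"
    by (meson closed_closure closed_sequentially)
qed

section \<open>Subgradients and the proximal map\<close>

lemma convex_funD:
  assumes "convex_fun f" "f x \<le> ereal r" "f y \<le> ereal s" "0 \<le> t" "t \<le> 1"
  shows "f ((1 - t) *\<^sub>R x + t *\<^sub>R y) \<le> ereal ((1 - t) * r + t * s)"
proof -
  have "(1 - t) *\<^sub>R (x, r) + t *\<^sub>R (y, s) \<in> epigraph f"
    using assms unfolding convex_fun_def epigraph_def by (intro convexD) auto
  then show ?thesis by (simp add: epigraph_def)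
qed

text \<open>Testing the subgradient inequality at a point of the domain excludes the value infinity,
  so later inequalities can be handled in the reals.\<close>

lemma subdifferential_finite:
  assumes "proper_fun f" "a \<in> subdifferential f x"
  obtains r where "f x = ereal r"
proof -
  obtain y where "f y < \<infinity>"
    using assms(1) by (auto simp: proper_fun_def eff_domain_def)
  moreover have "f x + ereal (a \<bullet> (y - x)) \<le> f y"
    using assms(2) by (simp add: subdifferential_def)
  ultimately have "f x \<noteq> \<infinity>" by auto
  moreover have "f x \<noteq> -\<infinity>" using assms(1) by (simp add: proper_fun_def)
  ultimately show thesis using that by (cases "f x") auto
qed

lemma subdifferential_monotone:
  assumes "proper_fun f" "a \<in> subdifferential f x" "b \<in> subdifferential f y"
  shows "0 \<le> (a - b) \<bullet> (x - y)"
proof -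
  obtain r where "f x = ereal r"
    using assms(1,2) by (rule subdifferential_finite)
  moreover obtain s where "f y = ereal s"
    using assms(1,3) by (rule subdifferential_finite)
  moreover have "f x + ereal (a \<bullet> (y - x)) \<le> f y" "f y + ereal (b \<bullet> (x - y)) \<le> f x"
    using assms by (auto simp: subdifferential_def)
  ultimately show ?thesis by (simp add: inner_simps)
qed

text \<open>
  Lower semicontinuity bounds \<open>f\<close> below near a point of its domain, and convexity propagates the
  bound radially; no Hahn-Banach argument is needed.
\<close>

lemma convex_lsc_lower_bound:
  fixes f :: "'a::real_normed_vector \<Rightarrow> ereal"
  assumes "lsc_fun f" "convex_fun f" "f x0 = ereal r0"
  shows "\<exists>L\<ge>0. \<exists>m. \<forall>y. ereal (m - L * norm (y - x0)) \<le> f y"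
proof -
  have "\<forall>\<^sub>F y in nhds x0. ereal (r0 - 1) < f y"
    using assms by (intro lsc_fun_eventually_nhds) auto
  then obtain d where d: "d > 0" "\<And>y. dist y x0 < d \<Longrightarrow> ereal (r0 - 1) < f y"
    unfolding eventually_nhds_metric by blast
  have "ereal (r0 - 1 - (2 / d) * norm (y - x0)) \<le> f y" for y
  proof (cases "norm (y - x0) < d")
    case True
    then have "ereal (r0 - 1) < f y" using d by (simp add: dist_norm)
    moreover have "ereal (r0 - 1 - (2 / d) * norm (y - x0)) \<le> ereal (r0 - 1)"
      using d by simp
    ultimately show ?thesis by (meson less_imp_le order_trans)
  next
    case False
    \<comment> \<open>The point of the segment from \<open>x0\<close> to \<open>y\<close> at
      distance \<open>d / 2\<close> from \<open>x0\<close> lies in the ball where \<open>f\<close>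
      exceeds \<open>r0 - 1\<close>. The slope \<open>2 / d\<close> makes \<open>t * q = 1\<close>,
      so a value of \<open>f y\<close> below the claimed bound would pull \<open>f\<close> at that
      point under \<open>r0 - 1\<close>.\<close>
    define t where "t = d / (2 * norm (y - x0))"
    have n: "norm (y - x0) > 0" using False d by linarith
    have t: "0 < t" "t \<le> 1" using False d n by (auto simp: t_def field_simps)
    have "(1 - t) *\<^sub>R x0 + t *\<^sub>R y - x0 = t *\<^sub>R (y - x0)" by (simp add: algebra_simps)
    then have "dist ((1 - t) *\<^sub>R x0 + t *\<^sub>R y) x0 = d / 2"
      using n d(1) by (simp add: dist_norm t_def)
    then have *: "ereal (r0 - 1) < f ((1 - t) *\<^sub>R x0 + t *\<^sub>R y)" using d by simp
    define q where "q = (2 / d) * norm (y - x0)"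
    have tq: "t * q = 1" using n d(1) by (simp add: t_def q_def)
    have "ereal (r0 - 1 - q) \<le> f y"
    proof (rule ccontr)
      assume "\<not> ereal (r0 - 1 - q) \<le> f y"
      then have "f y \<le> ereal (r0 - 1 - q)" by simp
      from convex_funD[OF assms(2) _ this, of x0 r0 t] assms(3) t
      have "f ((1 - t) *\<^sub>R x0 + t *\<^sub>R y) \<le> ereal ((1 - t) * r0 + t * (r0 - 1 - q))" by simp
      with * have "ereal (r0 - 1) < ereal ((1 - t) * r0 + t * (r0 - 1 - q))"
        by (rule less_le_trans)
      moreover have "(1 - t) * r0 + t * (r0 - 1 - q) = r0 - t - t * q"
        by (simp add: algebra_simps)
      ultimately show False using t(1) tq by simp
    qed
    then show ?thesis by (simp add: q_def)
  qed
  then show ?thesis using d(1) by (intro exI[of _ "2 / d"]) auto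
qed

section \<open>Existence and uniqueness of proximal points\<close>

lemma prox_minimizer_exists:
  fixes f :: "'a::{real_inner, complete_space} \<Rightarrow> ereal"
  assumes "proper_fun f" "lsc_fun f" "convex_fun f"
  shows "\<exists>p. \<forall>y. f p + ereal ((1/2) * (dist x p)\<^sup>2) \<le> f y + ereal ((1/2) * (dist x y)\<^sup>2)"
proof -
  have not_MInf: "f y \<noteq> -\<infinity>" for y using assms(1) by (simp add: proper_fun_def)
  obtain x0 where "f x0 < \<infinity>"
    using assms(1) by (auto simp: proper_fun_def eff_domain_def)
  then obtain r0 where r0: "f x0 = ereal r0"
    using not_MInf[of x0] by (cases "f x0") auto
  obtain L m where L: "L \<ge> 0" "\<And>y. ereal (m - L * norm (y - x0)) \<le> f y"
    using convex_lsc_lower_bound[OF assms(2,3) r0] by blast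
  show ?thesis
  \<comment> \<open>The quadratic absorbs the linear decay of \<open>f\<close>: after the triangle
    inequality, \<open>t\<^sup>2 / 2 - L * t\<close> is at least \<open>- L\<^sup>2 / 2\<close> for
    \<open>t = dist x y\<close>.\<close>
  proof (rule midpoint_strongly_convex_attains_min[
      where m = "m - L * norm (x - x0) - L\<^sup>2 / 2" and c = "1/8" and w = x0])
    fix y c assume c: "ereal c < f y + ereal ((1/2) * (dist x y)\<^sup>2)"
    then have "ereal (c - (1/2) * (dist x y)\<^sup>2) < f y"
      using not_MInf[of y] by (cases "f y") auto
    \<comment> \<open>The number \<open>d\<close> splits the slack, leaving a strict inequality both
      for \<open>f\<close> and for the quadratic term.\<close>
    then obtain d where d: "c - (1/2) * (dist x y)\<^sup>2 < d" "ereal d < f y"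
      by (metis ereal_dense2 less_ereal.simps(1))
    have "((\<lambda>z. (1/2) * (dist x z)\<^sup>2) \<longlongrightarrow> (1/2) * (dist x y)\<^sup>2) (nhds y)"
      by (intro tendsto_intros filterlim_ident)
    then have "\<forall>\<^sub>F z in nhds y. c - d < (1/2) * (dist x z)\<^sup>2"
      using d(1) by (intro order_tendstoD) auto
    moreover have "\<forall>\<^sub>F z in nhds y. ereal d < f z"
      using assms(2) d(2) by (rule lsc_fun_eventually_nhds)
    ultimately show "\<forall>\<^sub>F z in nhds y. ereal c < f z + ereal ((1/2) * (dist x z)\<^sup>2)"
    proof eventually_elim
      case (elim z)
      then show ?case by (cases "f z") auto
    qed
  next
    fix y
    have "norm (y - x0) \<le> dist x y + norm (x - x0)"
      by (metis dist_commute dist_norm dist_triangle)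
    then have "L * norm (y - x0) \<le> L * (dist x y + norm (x - x0))"
      using L(1) by (rule mult_left_mono)
    moreover have "0 \<le> (dist x y - L)\<^sup>2" by simp
    ultimately have "m - L * norm (x - x0) - L\<^sup>2 / 2
        \<le> m - L * norm (y - x0) + (1/2) * (dist x y)\<^sup>2"
      by (simp add: power2_eq_square algebra_simps)
    then show "ereal (m - L * norm (x - x0) - L\<^sup>2 / 2) \<le> f y + ereal ((1/2) * (dist x y)\<^sup>2)"
      using L(2)[of y] by (cases "f y") auto
  next
    fix y z r s
    let ?F = "\<lambda>y. f y + ereal ((1/2) * (dist x y)\<^sup>2)"
    assume "?F y \<le> ereal r" "?F z \<le> ereal s"
    then have "f y \<le> ereal (r - (1/2) * (dist x y)\<^sup>2)" "f z \<le> ereal (s - (1/2) * (dist x z)\<^sup>2)"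
      using not_MInf[of y] not_MInf[of z] by (cases "f y"; cases "f z"; simp)+
    from convex_funD[OF assms(3) this, of "1/2"]
    have "f (midpoint y z) \<le> ereal ((1/2) * (r - (1/2) * (dist x y)\<^sup>2) + (1/2) * (s - (1/2) * (dist x z)\<^sup>2))"
      by (simp add: midpoint_def scaleR_add_right)
    then show "?F (midpoint y z) \<le> ereal ((r + s) / 2 - (1/8) * (dist y z)\<^sup>2)"
      by (cases "f (midpoint y z)") (auto simp: dist_midpoint_sq field_simps)
  qed (use r0 in auto)
qed

text \<open>Fermat's rule by hand: compare the minimizer \<open>p\<close> with the point
  \<open>?z\<close> at parameter \<open>t\<close> on the segment to \<open>y\<close>, bound
  \<open>f ?z\<close> by convexity, divide by \<open>t\<close> and let \<open>t\<close> decrease to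
  0.\<close>

lemma prox_exists:
  fixes f :: "'a::{real_inner, complete_space} \<Rightarrow> ereal"
  assumes "proper_fun f" "lsc_fun f" "convex_fun f"
  shows "\<exists>p. x - p \<in> subdifferential f p"
proof -
  have not_MInf: "f y \<noteq> -\<infinity>" for y using assms(1) by (simp add: proper_fun_def)
  obtain p where p: "\<And>y. f p + ereal ((1/2) * (dist x p)\<^sup>2) \<le> f y + ereal ((1/2) * (dist x y)\<^sup>2)"
    using prox_minimizer_exists[OF assms] by blast
  obtain x0 where "f x0 < \<infinity>"
    using assms(1) by (auto simp: proper_fun_def eff_domain_def)
  with p[of x0] not_MInf[of p] obtain r where r: "f p = ereal r"
    by (cases "f p") auto
  have "f p + ereal ((x - p) \<bullet> (y - p)) \<le> f y" for y
  proof (cases "f y")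
    case (real s)
    have "(x - p) \<bullet> (y - p) - (s - r) \<le> t * ((1/2) * (norm (y - p))\<^sup>2)" if t: "0 < t" "t \<le> 1" for t
    proof -
      let ?z = "(1 - t) *\<^sub>R p + t *\<^sub>R y"
      have "f ?z \<le> ereal ((1 - t) * r + t * s)"
        using convex_funD[OF assms(3), of p r y s t] r real t by simp
      then have "r + (1/2) * (dist x p)\<^sup>2 \<le> (1 - t) * r + t * s + (1/2) * (dist x ?z)\<^sup>2"
        using p[of ?z] r by (cases "f ?z") auto
      moreover have "(dist x ?z)\<^sup>2 = (dist x p)\<^sup>2 - 2 * t * ((x - p) \<bullet> (y - p)) + t\<^sup>2 * (norm (y - p))\<^sup>2"
      proof -
        have "x - ?z = (x - p) - t *\<^sub>R (y - p)" by (simp add: algebra_simps)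
        then show ?thesis
          unfolding dist_norm power2_norm_eq_inner
          by (simp add: inner_diff_left inner_diff_right inner_commute power2_eq_square algebra_simps)
      qed
      ultimately have "t * ((x - p) \<bullet> (y - p) - (s - r)) \<le> t * (t * ((1/2) * (norm (y - p))\<^sup>2))"
        by (simp add: algebra_simps power2_eq_square)
      then show ?thesis using t by simp
    qed
    then have "\<forall>\<^sub>F t in at_right 0. (x - p) \<bullet> (y - p) - (s - r) \<le> t * ((1/2) * (norm (y - p))\<^sup>2)"
      by (intro eventually_at_rightI[of 0 1]) auto
    moreover have "((\<lambda>t. t * ((1/2) * (norm (y - p))\<^sup>2)) \<longlongrightarrow> 0 * ((1/2) * (norm (y - p))\<^sup>2)) (at_right 0)"
      by (intro tendsto_intros)
    ultimately have "(x - p) \<bullet> (y - p) - (s - r) \<le> 0 * ((1/2) * (norm (y - p))\<^sup>2)"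
      by (intro tendsto_lowerbound) auto
    then show ?thesis using r real by simp
  qed (use not_MInf in auto)
  then show ?thesis unfolding subdifferential_def by blast
qed

text \<open>For a second decomposition \<open>x = q + b\<close>, monotonicity gives a nonnegative
  inner product equal to \<open>- ((q - p) \<bullet> (q - p))\<close>, hence
  \<open>q = p\<close>.\<close>

lemma prox_eqI:
  assumes "proper_fun f" "a \<in> subdifferential f p" "x = p + a"
  shows "prox f x = p"
  unfolding prox_def
proof (rule the_equality)
  show "x \<in> {p + u |u. u \<in> subdifferential f p}" using assms by auto
next
  fix q assume "x \<in> {q + u |u. u \<in> subdifferential f q}"
  then obtain b where b: "x = q + b" "b \<in> subdifferential f q" by blast
  have "0 \<le> (b - a) \<bullet> (q - p)"
    using subdifferential_monotone[OF assms(1) b(2) assms(2)] .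
  moreover have "b - a = - (q - p)" using b(1) assms(3) by (simp add: algebra_simps)
  ultimately have "(q - p) \<bullet> (q - p) \<le> 0" by (simp only: inner_minus_left)
  then show "q = p" by (simp add: inner_gt_zero_iff leD order.order_iff_strict)
qed

lemma prox_subdifferential:
  fixes f :: "'a::{real_inner, complete_space} \<Rightarrow> ereal"
  assumes "proper_fun f" "lsc_fun f" "convex_fun f"
  shows "x - prox f x \<in> subdifferential f (prox f x)"
proof -
  obtain p where "x - p \<in> subdifferential f p" using prox_exists[OF assms] by blast
  moreover from prox_eqI[OF assms(1) this] have "prox f x = p" by simp
  ultimately show ?thesis by simp
qed

section \<open>Reflected proximal maps\<close>

text \<open>Kept as an identity because the subtracted inner product is the monotonicity gap of the
  subdifferential: its sign gives nonexpansiveness, its size drives the convergence.\<close>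

lemma refl_prox_norm_diff_sq:
  "(norm (refl_prox f x - refl_prox f y))\<^sup>2
    = (norm (x - y))\<^sup>2
      - 4 * (((x - prox f x) - (y - prox f y)) \<bullet> (prox f x - prox f y))"
proof -
  define a b where "a = x - y" and "b = prox f x - prox f y"
  have refl: "refl_prox f x - refl_prox f y = 2 *\<^sub>R b - a"
    by (simp add: refl_prox_def a_def b_def scaleR_diff_right)
  have diff: "(x - prox f x) - (y - prox f y) = a - b"
    by (simp add: a_def b_def)
  show ?thesis
    unfolding refl diff a_def[symmetric] b_def[symmetric] power2_norm_eq_inner
    by (simp add: inner_diff_left inner_diff_right inner_commute)
qed

lemma refl_prox_nonexpansive:
  fixes f :: "'a::{real_inner, complete_space} \<Rightarrow> ereal"
  assumes "proper_fun f" "lsc_fun f" "convex_fun f"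
  shows "norm (refl_prox f x - refl_prox f y) \<le> norm (x - y)"
proof -
  have "0 \<le> ((x - prox f x) - (y - prox f y)) \<bullet> (prox f x - prox f y)"
    using prox_subdifferential[OF assms] by (intro subdifferential_monotone[OF assms(1)])
  then have "(norm (refl_prox f x - refl_prox f y))\<^sup>2 \<le> (norm (x - y))\<^sup>2"
    unfolding refl_prox_norm_diff_sq by simp
  then show ?thesis by (rule power2_le_imp_le) simp
qed

section \<open>Uniform convexity and uniform monotonicity\<close>

text \<open>At the midpoint of \<open>x\<close> and \<open>y\<close>, uniform convexity bounds
  \<open>f\<close> from above and the subgradient from below. Since \<open>\<phi>\<close> is
  increasing, one constant serves all pairs at distance at least \<open>e\<close>.\<close>

lemma uniformly_convex_subgradient_gap:
  assumes "proper_fun f" "uniformly_convex f" "e > 0"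
  shows "\<exists>c>0. \<forall>x y a. a \<in> subdifferential f x \<longrightarrow> e \<le> norm (y - x) \<longrightarrow>
    f x + ereal (a \<bullet> (y - x) + c) \<le> f y"
proof -
  obtain \<phi> where "uniformly_convex_with \<phi> f"
    using assms(2) unfolding uniformly_convex_def by blast
  then have mono: "mono_on {0..} \<phi>" and nn: "\<And>t. t \<ge> 0 \<Longrightarrow> 0 \<le> \<phi> t"
    and zero: "\<And>t. t \<ge> 0 \<Longrightarrow> \<phi> t = 0 \<longleftrightarrow> t = 0"
    and uc: "\<And>x y \<alpha>. x \<in> eff_domain f \<Longrightarrow> y \<in> eff_domain f \<Longrightarrow> \<alpha> \<in> {0<..<1} \<Longrightarrow>
        f (\<alpha> *\<^sub>R x + (1 - \<alpha>) *\<^sub>R y) + ereal (\<alpha> * (1 - \<alpha>)) * \<phi> (norm (x - y))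
          \<le> ereal \<alpha> * f x + ereal (1 - \<alpha>) * f y"
    unfolding uniformly_convex_with_def by auto
  have "\<phi> e \<noteq> 0" "0 \<le> \<phi> e" using nn[of e] zero[of e] assms(3) by auto
  then have "0 < \<phi> e" by (metis order.not_eq_order_implies_strict)
  \<comment> \<open>\<open>\<phi> e\<close> may be infinite, so a finite positive number below it is
    used. The weight 1/4 at the midpoint becomes 1/2 after doubling, whence the gap
    \<open>c / 2\<close>.\<close>
  then obtain c where c: "0 < ereal c" "ereal c < \<phi> e"
    by (metis ereal_dense2 zero_ereal_def)
  have "f x + ereal (a \<bullet> (y - x) + c / 2) \<le> f y"
    if a: "a \<in> subdifferential f x" and "e \<le> norm (y - x)" for x y a
  proof (cases "f y")
    case (real s)
    obtain r where r: "f x = ereal r" using a assms(1) subdifferential_finite by blast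
    let ?z = "(1/2) *\<^sub>R x + (1/2) *\<^sub>R y"
    have "\<phi> e \<le> \<phi> (norm (x - y))"
      using that(2) assms(3) by (intro mono_onD[OF mono]) (auto simp: norm_minus_commute)
    with c have \<phi>: "ereal c \<le> \<phi> (norm (x - y))" by simp
    have "f ?z + ereal (1/4) * \<phi> (norm (x - y)) \<le> ereal ((1/2) * r + (1/2) * s)"
      using uc[of x y "1/2"] r real by (simp add: eff_domain_def)
    moreover have "f ?z + ereal (1/4) * ereal c \<le> f ?z + ereal (1/4) * \<phi> (norm (x - y))"
      using \<phi> by (intro add_left_mono ereal_mult_left_mono) auto
    moreover have "f x + ereal (a \<bullet> (?z - x)) \<le> f ?z"
      using a by (simp add: subdifferential_def)
    moreover have "f ?z \<noteq> -\<infinity>" using assms(1) by (simp add: proper_fun_def)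
    moreover have "?z - x = (1/2) *\<^sub>R (y - x)"
    proof -
      have "?z - x = (1/2) *\<^sub>R (x + y) - (1/2) *\<^sub>R (x + x)"
        by (simp only: scaleR_half_double) (simp only: scaleR_add_right)
      then show ?thesis
        by (simp only: scaleR_diff_right[symmetric] add_diff_cancel_left)
    qed
    ultimately have "r + (1/2) * (a \<bullet> (y - x)) + c / 4 \<le> (1/2) * r + (1/2) * s"
      using r by (cases "f ?z"; cases "\<phi> (norm (x - y))") auto
    then show ?thesis using r real by simp
  next
    case MInf
    then show ?thesis using assms(1) by (simp add: proper_fun_def)
  qed simp
  then show ?thesis using c(1) by (intro exI[of _ "c/2"]) auto
qed

text \<open>Add the gap inequality to itself with the two points exchanged; the function values
  cancel.\<close>

lemma uniformly_convex_uniformly_monotone: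
  assumes "proper_fun f" "uniformly_convex f" "e > 0"
  shows "\<exists>c>0. \<forall>x y a b. a \<in> subdifferential f x \<longrightarrow> b \<in> subdifferential f y \<longrightarrow>
    e \<le> norm (x - y) \<longrightarrow> c \<le> (a - b) \<bullet> (x - y)"
proof -
  obtain c where c: "c > 0" "\<And>x y a. a \<in> subdifferential f x \<Longrightarrow> e \<le> norm (y - x) \<Longrightarrow>
      f x + ereal (a \<bullet> (y - x) + c) \<le> f y"
    using uniformly_convex_subgradient_gap[OF assms] by blast
  have "2 * c \<le> (a - b) \<bullet> (x - y)"
    if a: "a \<in> subdifferential f x" and b: "b \<in> subdifferential f y" and xy: "e \<le> norm (x - y)"
    for x y a b
  proof -
    obtain r where "f x = ereal r"
      using assms(1) a by (rule subdifferential_finite)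
    moreover obtain s where "f y = ereal s"
      using assms(1) b by (rule subdifferential_finite)
    ultimately show ?thesis
      using c(2)[OF a, of y] c(2)[OF b, of x] xy
      by (simp add: norm_minus_commute inner_simps)
  qed
  then show ?thesis using c(1) by (intro exI[of _ "2 * c"]) auto
qed

section \<open>Solutions, displacements and shadows\<close>

lemma displacement_eq_prox_diff:
  "x - (1/2) *\<^sub>R (x + refl_prox g (refl_prox f x)) = prox f x - prox g (refl_prox f x)"
proof -
  have "x + refl_prox g (refl_prox f x) = 2 *\<^sub>R (x - (prox f x - prox g (refl_prox f x)))"
    by (simp add: refl_prox_def algebra_simps scaleR_2)
  then show ?thesis by simp
qed

text \<open>The point \<open>x + a\<close> has proximal point \<open>x\<close> and reflection
  \<open>x - a = (x - v) + (v - a)\<close>, so the proximal map of \<open>g\<close> sends that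
  reflection to \<open>x - v\<close>.\<close>

lemma solution_imp_displacement:
  assumes "proper_fun f" "proper_fun g"
    and "a \<in> subdifferential f x" "v - a \<in> subdifferential g (x - v)"
  shows "(x + a) - (1/2) *\<^sub>R ((x + a) + refl_prox g (refl_prox f (x + a))) = v"
proof -
  have p: "prox f (x + a) = x" using prox_eqI[OF assms(1,3)] by simp
  have "refl_prox f (x + a) = (x - v) + (v - a)"
    by (simp add: refl_prox_def p scaleR_2)
  from prox_eqI[OF assms(2,4) this]
  show "(x + a) - (1/2) *\<^sub>R ((x + a) + refl_prox g (refl_prox f (x + a))) = v"
    unfolding displacement_eq_prox_diff p by simp
qed

text \<open>The converse passage: the proximal residuals of \<open>f\<close> and \<open>g\<close>
  are subgradients, and displacement \<open>v\<close> makes them add up to \<open>v\<close>. Thus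
  \<open>prox f z\<close> is a solution.\<close>

lemma displacement_imp_solution:
  fixes f g :: "'a::{real_inner, complete_space} \<Rightarrow> ereal"
  assumes "proper_fun f" "lsc_fun f" "convex_fun f" "proper_fun g" "lsc_fun g" "convex_fun g"
    and "z - (1/2) *\<^sub>R (z + refl_prox g (refl_prox f z)) = v"
  shows "z - prox f z \<in> subdifferential f (prox f z)"
    and "v - (z - prox f z) \<in> subdifferential g (prox f z - v)"
proof -
  show "z - prox f z \<in> subdifferential f (prox f z)"
    by (rule prox_subdifferential[OF assms(1-3)])
  have q: "prox g (refl_prox f z) = prox f z - v"
    using assms(7) unfolding displacement_eq_prox_diff by (simp add: algebra_simps)
  have "refl_prox f z - (prox f z - v) = v - (z - prox f z)"
    by (simp add: refl_prox_def algebra_simps scaleR_2)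
  with prox_subdifferential[OF assms(4-6), of "refl_prox f z"]
  show "v - (z - prox f z) \<in> subdifferential g (prox f z - v)"
    unfolding q by simp
qed

text \<open>The subgradients \<open>a\<close> and \<open>v - a\<close> sum to \<open>v\<close>,
  whose linear contribution is cancelled by the term \<open>- (x \<bullet> v)\<close>. What remains
  is the positive gap from uniform convexity, so \<open>x\<close> is a strict minimizer.\<close>

lemma solution_unique_minimizer:
  assumes "proper_fun f" "proper_fun g" "uniformly_convex f"
    and a: "a \<in> subdifferential f x" "v - a \<in> subdifferential g (x - v)"
  shows "argmin_set (\<lambda>x. ereal (- (x \<bullet> v)) + f x + g (x - v)) = {x}"
proof -
  let ?F = "\<lambda>x. ereal (- (x \<bullet> v)) + f x + g (x - v)"
  have less: "?F x < ?F y" if "y \<noteq> x" for y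
  proof -
    have "norm (y - x) > 0" using that by simp
    from uniformly_convex_subgradient_gap[OF assms(1,3) this] a(1)
    obtain c where c: "c > 0" "f x + ereal (a \<bullet> (y - x) + c) \<le> f y" by blast
    have g: "g (x - v) + ereal ((v - a) \<bullet> (y - x)) \<le> g (y - v)"
      using a(2) unfolding subdifferential_def by (auto dest!: spec[of _ "y - v"])
    obtain r where r: "f x = ereal r"
      using assms(1) a(1) by (rule subdifferential_finite)
    obtain s where s: "g (x - v) = ereal s"
      using assms(2) a(2) by (rule subdifferential_finite)
    show ?thesis
      using c g r s
      by (cases "f y"; cases "g (y - v)") (auto simp: inner_diff_left inner_diff_right inner_commute)
  qed
  then have "\<not> ?F y < ?F x" for y
    by (metis less_asym less_irrefl)
  with less show ?thesis
    unfolding argmin_set_def is_arg_min_def by auto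
qed

text \<open>The displacement along the orbit never grows in norm, and \<open>v\<close> is the only one of least norm.\<close>

lemma minimal_displacement_orbit:
  fixes N :: "'a::{real_inner, complete_space} \<Rightarrow> 'a"
  assumes nonexp: "\<And>x y. norm (N x - N y) \<le> norm (x - y)"
    and T: "T = (\<lambda>x. (1/2) *\<^sub>R (x + N x))"
    and v: "v = metric_proj (closure (range (\<lambda>x. x - T x))) 0"
    and z: "z - T z = v"
  shows "(N ^^ n) z - T ((N ^^ n) z) = v"
proof (induction n)
  case 0
  show ?case using z by simp
next
  case (Suc n)
  have disp: "x - T x = (1/2) *\<^sub>R (x - N x)" for x
  proof -
    have "x - T x = (1/2) *\<^sub>R (x + x) - (1/2) *\<^sub>R (x + N x)"
      by (simp only: T scaleR_half_double)
    then show ?thesis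
      by (simp only: scaleR_diff_right[symmetric] add_diff_cancel_left)
  qed
  have "norm (T x - T y) \<le> norm (x - y)" for x y
  proof -
    have "T x - T y = (1/2) *\<^sub>R ((x - y) + (N x - N y))" by (simp add: T algebra_simps)
    then have "norm (T x - T y) \<le> (1/2) * (norm (x - y) + norm (N x - N y))"
      using norm_triangle_ineq[of "x - y" "N x - N y"] by simp
    then show ?thesis using nonexp[of x y] by simp
  qed
  then have D: "convex (closure (range (\<lambda>x. x - T x)))"
    by (rule convex_closure_nonexpansive_displacement)
  let ?y = "(N ^^ n) z"
  have "norm (N ?y - T (N ?y)) = (1/2) * norm (N ?y - N (N ?y))" unfolding disp by simp
  also have "\<dots> \<le> (1/2) * norm (?y - N ?y)" using nonexp by simp
  also have "\<dots> = norm (?y - T ?y)" unfolding disp by simp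
  also have "\<dots> = norm v" using Suc.IH by simp
  finally have le: "dist 0 (N ?y - T (N ?y)) \<le> dist 0 v" by simp
  have mem: "N ?y - T (N ?y) \<in> closure (range (\<lambda>x. x - T x))"
    by (rule subsetD[OF closure_subset]) (rule rangeI)
  from metric_proj_unique[OF closed_closure D mem le[unfolded v]]
  show ?case unfolding v by simp
qed

text \<open>The gap \<open>s n\<close> enters the decrease of \<open>d\<close> through the identity
  for \<open>refl_prox f\<close>, while \<open>refl_prox g\<close> never increases
  distances.\<close>

lemma shadow_orbits_merge:
  fixes f g :: "'a::{real_inner, complete_space} \<Rightarrow> ereal"
  assumes f: "proper_fun f" "lsc_fun f" "convex_fun f"
    and g: "proper_fun g" "lsc_fun g" "convex_fun g"
    and uc: "uniformly_convex f"
  shows "(\<lambda>n. prox f (((refl_prox g \<circ> refl_prox f) ^^ n) x)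
    - prox f (((refl_prox g \<circ> refl_prox f) ^^ n) z)) \<longlonglongrightarrow> 0"
proof -
  define X where "X = (\<lambda>n. ((refl_prox g \<circ> refl_prox f) ^^ n) x)"
  define Y where "Y = (\<lambda>n. ((refl_prox g \<circ> refl_prox f) ^^ n) z)"
  define d where "d = (\<lambda>n. (norm (X n - Y n))\<^sup>2)"
  define s where "s = (\<lambda>n. ((X n - prox f (X n)) - (Y n - prox f (Y n))) \<bullet> (prox f (X n) - prox f (Y n)))"
  have s_nonneg: "0 \<le> s n" for n
    unfolding s_def using prox_subdifferential[OF f] by (intro subdifferential_monotone[OF f(1)])
  have step: "d (Suc n) \<le> d n - 4 * s n" for n
  proof -
    have "norm (X (Suc n) - Y (Suc n)) \<le> norm (refl_prox f (X n) - refl_prox f (Y n))"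
      using refl_prox_nonexpansive[OF g] by (simp add: X_def Y_def)
    then have "d (Suc n) \<le> (norm (refl_prox f (X n) - refl_prox f (Y n)))\<^sup>2"
      by (simp add: d_def power_mono)
    then show ?thesis unfolding refl_prox_norm_diff_sq d_def s_def .
  qed
  have "d (Suc n) \<le> d n" for n
    using step[of n] s_nonneg[of n] by linarith
  then have "decseq d" by (rule decseq_SucI)
  then obtain l where l: "d \<longlonglongrightarrow> l"
    using decseq_convergent[of d 0] by (auto simp: d_def)
  \<comment> \<open>Successive differences of the convergent sequence \<open>d\<close> vanish, and
    by \<open>step\<close> they dominate \<open>4 * s n\<close>.\<close>
  have "(\<lambda>n. (d n - d (Suc n)) / 4) \<longlonglongrightarrow> (l - l) / 4"
    by (intro tendsto_divide tendsto_diff tendsto_const l LIMSEQ_Suc[OF l]) simp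
  then have "s \<longlonglongrightarrow> 0"
    using step s_nonneg
    by (intro tendsto_sandwich[of "\<lambda>_. 0" s sequentially "\<lambda>n. (d n - d (Suc n)) / 4"] always_eventually allI)
       (auto simp: field_simps)
  have "(\<lambda>n. prox f (X n) - prox f (Y n)) \<longlonglongrightarrow> 0"
  proof (rule tendstoI)
    fix e :: real assume "e > 0"
    from uniformly_convex_uniformly_monotone[OF f(1) uc this]
    obtain c where c: "c > 0" "\<And>x y a b. a \<in> subdifferential f x \<Longrightarrow> b \<in> subdifferential f y \<Longrightarrow>
        e \<le> norm (x - y) \<Longrightarrow> c \<le> (a - b) \<bullet> (x - y)" by blast
    have "\<forall>\<^sub>F n in sequentially. s n < c"
      using \<open>s \<longlonglongrightarrow> 0\<close> c(1) by (rule order_tendstoD)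
    then show "\<forall>\<^sub>F n in sequentially. dist (prox f (X n) - prox f (Y n)) 0 < e"
    proof eventually_elim
      case (elim n)
      show ?case
      proof (rule ccontr)
        assume "\<not> ?thesis"
        then have "c \<le> s n"
          unfolding s_def using prox_subdifferential[OF f] by (intro c(2)) auto
        with elim show False by simp
      qed
    qed
  qed
  then show ?thesis by (simp only: X_def Y_def)
qed

theorem theorem5p4:
  fixes f g :: "'a::{real_inner, complete_space} \<Rightarrow> ereal"
    and T Ttilde :: "'a \<Rightarrow> 'a" and v :: 'a and Z :: "'a set"
  assumes "proper_fun f" and "lsc_fun f" and "convex_fun f"
    and "proper_fun g" and "lsc_fun g" and "convex_fun g"
    and "Ttilde = refl_prox g \<circ> refl_prox f"
    and "T = (\<lambda>x. (1/2) *\<^sub>R (x + refl_prox g (refl_prox f x)))"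
    and "v = metric_proj (closure (range (\<lambda>x. x - T x))) 0"
    and "Z = {x. 0 \<in> {- v + a + b | a b. a \<in> subdifferential f x \<and> b \<in> subdifferential g (x - v)}}"
    and "Z \<noteq> {}"
    and "uniformly_convex f"
  shows "\<exists>xbar. Z = argmin_set (\<lambda>x. ereal (- (x \<bullet> v)) + f x + g (x - v))
      \<and> argmin_set (\<lambda>x. ereal (- (x \<bullet> v)) + f x + g (x - v)) = {xbar}
      \<and> (\<forall>x. (\<lambda>n. prox f ((Ttilde ^^ n) x)) \<longlonglongrightarrow> xbar)"
proof -
  let ?F = "\<lambda>x. ereal (- (x \<bullet> v)) + f x + g (x - v)"
  have Z_iff: "x \<in> Z \<longleftrightarrow> (\<exists>a. a \<in> subdifferential f x \<and> v - a \<in> subdifferential g (x - v))" for x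
  proof -
    have "0 = - v + a + b \<longleftrightarrow> b = v - a" for a b
      by (metis add.commute add_diff_cancel_left' diff_add_cancel eq_neg_iff_add_eq_0 minus_diff_eq uminus_add_conv_diff)
    then show ?thesis unfolding assms(10) by auto
  qed
  have argmin: "argmin_set ?F = {x}" if "x \<in> Z" for x
    using that solution_unique_minimizer[OF assms(1,4,12)] unfolding Z_iff by blast
  obtain xbar a where xbar: "xbar \<in> Z" "a \<in> subdifferential f xbar" "v - a \<in> subdifferential g (xbar - v)"
    using assms(11) Z_iff by blast
  \<comment> \<open>Each element of \<open>Z\<close> is the sole minimizer of the same function, so
    all of them coincide.\<close>
  have Z_eq: "Z = {xbar}"
    using argmin xbar(1) by (metis is_singletonI' is_singleton_the_elem singleton_iff singleton_inject empty_iff)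
  define z where "z = xbar + a"
  have z: "z - T z = v"
    unfolding assms(8) z_def by (rule solution_imp_displacement[OF assms(1,4) xbar(2,3)])
  have "norm (Ttilde x - Ttilde y) \<le> norm (x - y)" for x y
    unfolding assms(7) o_def
    using refl_prox_nonexpansive[OF assms(1-3)] refl_prox_nonexpansive[OF assms(4-6)] order_trans
    by blast
  moreover have "T = (\<lambda>x. (1/2) *\<^sub>R (x + Ttilde x))" by (simp add: assms(7,8))
  ultimately have orbit: "(Ttilde ^^ n) z - T ((Ttilde ^^ n) z) = v" for n
    using assms(9) z by (rule minimal_displacement_orbit)
  \<comment> \<open>Each iterate of \<open>z\<close> has displacement \<open>v\<close>, so its
    shadow lies in the singleton \<open>Z\<close>; the reference shadow sequence is
    constant.\<close>
  have shadow: "prox f ((Ttilde ^^ n) z) = xbar" for n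
    using displacement_imp_solution[OF assms(1-6) orbit[of n, unfolded assms(8)]] Z_iff Z_eq by blast
  have "(\<lambda>n. prox f ((Ttilde ^^ n) x)) \<longlonglongrightarrow> xbar" for x
    using shadow_orbits_merge[OF assms(1-6,12), of x z] shadow
    unfolding assms(7)[symmetric] by (simp add: LIM_zero_iff)
  then show ?thesis using argmin[OF xbar(1)] Z_eq by blast
qed

end
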